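(* For every integer $N$, writing $\mathcal{N} := \mathcal{N}(m,n_1,n_2) := N-m-n_1-n_2$, we have $$\sum_{m,n_1,n_2\geq 0} q^{A(n_1,n_2,m)} {3\mathcal{N}\brack m}_q {\mathcal{N} +\left\lfloor \frac{n_1}{2}\right\rfloor \brack \left\lfloor \frac{n_1}{2}\right\rfloor}_{q^6} {\mathcal{N} +\left\lfloor \frac{n_2}{2}\right\rfloor \brack \left\lfloor \frac{n_2}{2}\right\rfloor}_{q^6} = \sum_{j=-N}^N q^{\frac{j(3j-1)}{2}} {N;j;q^3\choose j}_2,$$ where $$A(n_1,n_2,m):= \frac{(2m+n_1+n_2 +1)(2m+n_1+n_2 )}{2} + m(n_1+n_2)+ (n_1+n_2)^2 -n_1.$$
   Context: Here $q$ is a variable and $m,n_1,n_2$ range over non-negative integers. For $n\ge 0$, $(a;q)_n=\prod_{i=0}^{n-1}(1-aq^i)$ and $(q)_n=(q;q)_n$. The $q$-binomial coefficient is, for integers $a,b$, ${a\brack b}_q=\frac{(q)_a}{(q)_{a-b}(q)_b}$ if $a\ge b\ge 0$, and ${a\brack b}_q=0$ otherwise; a subscript $q^6$ means $q$ is replaced by $q^6$. For integers $m,a,b$ the $q$-trinomial coefficient is ${m;b;q\choose a}_2 := \sum_{k\geq 0} q^{k(k+b)} {m\brack k}_q {m-k\brack k+a}_q$, and ${N;j;q^3\choose j}_2$ is this with $m=N$, $b=a=j$ and $q$ replaced by $q^3$. For negative $N$ the sum over $-N\le j\le N$ is empty (both sides are $0$). *)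

theory Defs
  imports
    "HOL-Computational_Algebra.Computational_Algebra"
    "HOL-Library.Groups_Big_Fun"
begin

text \<open>
  The variable \<open>q\<close> is the indeterminate of the rational function field \<open>\<rat>(q)\<close>.
  The \<open>q\<close>-objects below are defined over an arbitrary field, with the base as an argument, so
  that replacing \<open>q\<close> by \<open>q\<^sup>3\<close> or \<open>q\<^sup>6\<close> is plain instantiation; the quotient defining
  \<open>qbinomial\<close> is meaningful only at bases that are not roots of unity, such as powers of \<open>qvar\<close>.
\<close>

definition qvar :: "rat poly fract"
  where "qvar = to_fract [:0, 1:]"

definition qpochhammer :: "'a::field \<Rightarrow> 'a \<Rightarrow> nat \<Rightarrow> 'a"
  where "qpochhammer a q n = (\<Prod>i<n. 1 - a * q ^ i)"

definition qbinomial :: "'a::field \<Rightarrow> int \<Rightarrow> int \<Rightarrow> 'a"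
  where "qbinomial q a b =
    (if a \<ge> b \<and> b \<ge> 0
     then qpochhammer q q (nat a) / (qpochhammer q q (nat (a - b)) * qpochhammer q q (nat b))
     else 0)"

text \<open>
  \<open>Sum_any\<close> is the sum over a whole type of a function of finite support (and \<open>0\<close> if the support
  is infinite); the supports in question are shown to be finite below.
\<close>

definition qtrinomial :: "int \<Rightarrow> int \<Rightarrow> 'a::field \<Rightarrow> int \<Rightarrow> 'a"
  where "qtrinomial m b q a =
    Sum_any (\<lambda>k::nat. q powi (int k * (int k + b)) * qbinomial q m (int k)
                       * qbinomial q (m - int k) (int k + a))"

text \<open>The division is exact, being that of a product of two consecutive integers.\<close>

definition A_exp :: "int \<Rightarrow> int \<Rightarrow> int \<Rightarrow> int"
  where "A_exp n1 n2 m =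
    (2 * m + n1 + n2 + 1) * (2 * m + n1 + n2) div 2 + m * (n1 + n2) + (n1 + n2)\<^sup>2 - n1"

definition lhs_summand :: "int \<Rightarrow> nat \<Rightarrow> nat \<Rightarrow> nat \<Rightarrow> rat poly fract"
  where "lhs_summand N m n1 n2 =
    (let M = N - int m - int n1 - int n2 in
       qvar powi A_exp (int n1) (int n2) (int m)
       * qbinomial qvar (3 * M) (int m)
       * qbinomial (qvar ^ 6) (M + int (n1 div 2)) (int (n1 div 2))
       * qbinomial (qvar ^ 6) (M + int (n2 div 2)) (int (n2 div 2)))"

lemma qpochhammer_qvar_nonzero:
  assumes "d > 0"
  shows "qpochhammer (qvar ^ d) (qvar ^ d) n \<noteq> 0"
proof -
  have "1 - qvar ^ d * (qvar ^ d) ^ i \<noteq> 0" for i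
  proof -
    have pow: "to_fract p ^ k = to_fract (p ^ k)" for p :: "rat poly" and k
      by (induction k) auto
    have "([:0, 1:] :: rat poly) ^ (d * Suc i) = monom 1 (d * Suc i)"
      by (simp only: monom_altdef) simp
    moreover have "monom (1::rat) (d * Suc i) \<noteq> 1"
      using assms by (simp add: monom_eq_1_iff)
    ultimately have "qvar ^ (d * Suc i) \<noteq> to_fract 1"
      unfolding qvar_def pow to_fract_eq_iff by simp
    moreover have "qvar ^ d * (qvar ^ d) ^ i = qvar ^ (d * Suc i)"
      by (simp add: power_add power_mult)
    ultimately show ?thesis by simp
  qed
  then show ?thesis by (simp add: qpochhammer_def)
qed

lemma finite_support_qtrinomial:
  fixes q :: "'a::field"
  shows "finite {k::nat. q powi (int k * (int k + b)) * qbinomial q m (int k)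
                 * qbinomial q (m - int k) (int k + a) \<noteq> 0}"
proof (rule finite_subset)
  show "{k::nat. q powi (int k * (int k + b)) * qbinomial q m (int k)
          * qbinomial q (m - int k) (int k + a) \<noteq> 0} \<subseteq> {..nat m}"
  proof
    fix k :: nat
    assume "k \<in> {k. q powi (int k * (int k + b)) * qbinomial q m (int k)
              * qbinomial q (m - int k) (int k + a) \<noteq> 0}"
    then have "qbinomial q m (int k) \<noteq> 0"
      by auto
    then have "m \<ge> int k"
      unfolding qbinomial_def by meson
    then show "k \<in> {..nat m}"
      by simp
  qed
qed simp

lemma finite_support_lhs_summand:
  "finite {(m, n1, n2). lhs_summand N m n1 n2 \<noteq> 0}"
proof (rule finite_subset)
  show "{(m, n1, n2). lhs_summand N m n1 n2 \<noteq> 0} \<subseteq> {..nat N} \<times> {..nat N} \<times> {..nat N}"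
  proof clarify
    fix m n1 n2
    assume "lhs_summand N m n1 n2 \<noteq> 0"
    then have "qbinomial qvar (3 * (N - int m - int n1 - int n2)) (int m) \<noteq> 0"
      unfolding lhs_summand_def Let_def by force
    then have "3 * (N - int m - int n1 - int n2) \<ge> int m"
      unfolding qbinomial_def by meson
    then have "int m \<le> N" "int n1 \<le> N" "int n2 \<le> N"
      using of_nat_0_le_iff[of m, where ?'a = int] of_nat_0_le_iff[of n1, where ?'a = int]
        of_nat_0_le_iff[of n2, where ?'a = int] by (simp_all add: algebra_simps)
    then show "m \<in> {..nat N} \<and> (n1, n2) \<in> {..nat N} \<times> {..nat N}"
      by (simp add: le_nat_iff)
  qed
qed simp

end

theory Submission
  imports Defs
begin

text \<open>
  Write \<open>Q = q\<^sup>3\<close>, \<open>s = m + n\<^sub>1 + n\<^sub>2\<close> and \<open>M = N - s\<close>. Since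
  \<open>A = 3 (s choose 2) + (m choose 2) + 3 m + n\<^sub>1 + 2 n\<^sub>2\<close>, the part of the left-hand side with
  fixed \<open>s\<close> is \<open>Q\<close> to the power \<open>s choose 2\<close> times the coefficient of \<open>X\<^sup>s\<close> in
  \<open>(-q\<^sup>3 X; q)\<close> of length \<open>3 M\<close> times \<open>G(q) G(q\<^sup>2)\<close>, where \<open>G(c)\<close> is the generating function of
  the \<open>q\<^sup>6\<close>-binomials with floors, namely \<open>(1 + c X) / (c\<^sup>2 X\<^sup>2; Q\<^sup>2)\<close> with denominator of length
  \<open>M + 1\<close>. Splitting the first product by residues modulo \<open>3\<close>, two of its three factors cancel
  against \<open>G(q)\<close> and \<open>G(q\<^sup>2)\<close>, which leaves \<open>(-a b X; Q) / ((a X; Q) (b X; Q))\<close> with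
  \<open>a = q\<^sup>2\<close>, \<open>b = q\<close> (lengths \<open>M\<close>, \<open>M + 1\<close>, \<open>M + 1\<close>). For arbitrary \<open>a\<close> and \<open>b\<close>, the
  coefficient of \<open>a\<^sup>i b\<^sup>j\<close> in the resulting sum over \<open>s\<close> is evaluated by the \<open>q\<close>-Vandermonde
  identity to a multiple of a \<open>Q\<close>-multinomial coefficient, and these are the terms of the
  right-hand side.
\<close>

section \<open>Gaussian binomials with natural number arguments\<close>

definition gauss :: "'a::field \<Rightarrow> nat \<Rightarrow> nat \<Rightarrow> 'a"
  where "gauss q n k = qbinomial q (int n) (int k)"

text \<open>Equivalently, no positive power of \<open>q\<close> is \<open>1\<close>, so no quotient
  defining a q-binomial has a zero denominator.\<close>

abbreviation qgeneric :: "'a::field \<Rightarrow> bool"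
  where "qgeneric q \<equiv> (\<forall>n. qpochhammer q q n \<noteq> 0)"

lemma gauss_eq:
  "k \<le> n \<Longrightarrow> gauss q n k = qpochhammer q q n / (qpochhammer q q (n - k) * qpochhammer q q k)"
  by (simp add: gauss_def qbinomial_def nat_diff_distrib flip: of_nat_diff)

lemma gauss_eq_0: "n < k \<Longrightarrow> gauss q n k = 0"
  by (simp add: gauss_def qbinomial_def)

lemma qpochhammer_Suc: "qpochhammer q q (Suc n) = qpochhammer q q n * (1 - q ^ Suc n)"
  by (simp add: qpochhammer_def)

lemma gauss_0 [simp]: "qgeneric q \<Longrightarrow> gauss q n 0 = 1"
  using gauss_eq[of 0 n q] by (simp add: qpochhammer_def)

lemma gauss_self: "qgeneric q \<Longrightarrow> gauss q n n = 1"
  using gauss_eq[of n n q] by (simp add: qpochhammer_def)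

text \<open>The q-Pascal rule. Below the diagonal, after extracting a common factor, it is the
  partial fraction identity \<open>key\<close> in \<open>x = q ^ Suc k\<close> and
  \<open>y = q ^ Suc d\<close>.\<close>

lemma gauss_Suc_Suc:
  assumes q: "qgeneric q" and "k \<le> n"
  shows "gauss q (Suc n) (Suc k) = gauss q n (Suc k) + q ^ (n - k) * gauss q n k"
proof (cases "k = n")
  case True
  then show ?thesis
    using q by (simp add: gauss_self gauss_eq_0)
next
  case False
  with \<open>k \<le> n\<close> obtain d where d: "n = Suc (k + d)"
    using less_imp_Suc_add by (metis le_neq_implies_less)
  have nz: "1 - q ^ Suc i \<noteq> 0" for i
    using q[rule_format, of "Suc i"] by (simp only: qpochhammer_Suc) auto
  have diffs: "Suc n - Suc k = Suc d" "n - Suc k = d" "n - k = Suc d"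
    using d by auto
  have le: "Suc k \<le> Suc n" "Suc k \<le> n" "k \<le> n"
    using d by auto
  have pw: "q ^ Suc n = q ^ Suc k * q ^ Suc d"
    by (simp add: d power_add)
  define x where "x = q ^ Suc k"
  define y where "y = q ^ Suc d"
  have xy: "1 - x \<noteq> 0" "1 - y \<noteq> 0"
    unfolding x_def y_def by (rule nz)+
  have key: "(1 - x * y) / ((1 - y) * (1 - x)) = 1 / (1 - x) + y / (1 - y)"
    using xy by (simp add: divide_simps) (simp add: algebra_simps)
  let ?c = "qpochhammer q q n / (qpochhammer q q d * qpochhammer q q k)"
  have "gauss q (Suc n) (Suc k) = ?c * ((1 - x * y) / ((1 - y) * (1 - x)))"
    unfolding gauss_eq[OF le(1)] diffs qpochhammer_Suc pw x_def[symmetric] y_def[symmetric]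
    by (simp add: field_simps)
  also have "\<dots> = ?c * (1 / (1 - x)) + y * (?c * (1 / (1 - y)))"
    unfolding key distrib_left by simp
  also have "\<dots> = gauss q n (Suc k) + q ^ (n - k) * gauss q n k"
    unfolding gauss_eq[OF le(2)] gauss_eq[OF le(3)] diffs qpochhammer_Suc x_def[symmetric]
      y_def[symmetric] by (simp add: mult_ac)
  finally show ?thesis .
qed

section \<open>The products \<open>(-c X; q)\<close> as power series and the finite q-binomial
  theorem\<close>

definition qprod :: "'a::field \<Rightarrow> 'a \<Rightarrow> nat \<Rightarrow> 'a fps"
  where "qprod c q n = (\<Prod>i<n. 1 + fps_const (c * q ^ i) * fps_X)"

lemma qprod_0 [simp]: "qprod c q 0 = 1"
  by (simp add: qprod_def)

lemma qprod_Suc: "qprod c q (Suc n) = qprod c q n * (1 + fps_const (c * q ^ n) * fps_X)"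
  by (simp add: qprod_def)

lemma qprod_add: "qprod c q (m + n) = qprod c q m * qprod (c * q ^ m) q n"
  by (induction n) (simp_all add: qprod_Suc power_add mult_ac)

lemma qprod_triple:
  "qprod c q (3 * n) = qprod c (q ^ 3) n * qprod (c * q) (q ^ 3) n * qprod (c * q ^ 2) (q ^ 3) n"
proof (induction n)
  case (Suc n)
  have "qprod c q (3 * Suc n) = qprod c q (Suc (Suc (Suc (3 * n))))"
    by (simp add: numeral_3_eq_3)
  also have "\<dots> = qprod c q (3 * n) * (1 + fps_const (c * (q ^ 3) ^ n) * fps_X)
      * (1 + fps_const (c * q * (q ^ 3) ^ n) * fps_X)
      * (1 + fps_const (c * q\<^sup>2 * (q ^ 3) ^ n) * fps_X)"
    unfolding qprod_Suc power_Suc power_mult power2_eq_square by (simp only: mult_ac)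
  finally show ?case
    unfolding Suc.IH qprod_Suc by (simp only: mult_ac)
qed simp

lemma fps_nth_mult_linear_0: "fps_nth (F * (1 + fps_const c * fps_X)) 0 = fps_nth F 0"
  for c :: "'a::field"
  by (simp add: fps_mult_nth)

lemma fps_nth_mult_linear_Suc:
  "fps_nth (F * (1 + fps_const c * fps_X)) (Suc n) = fps_nth F (Suc n) + c * fps_nth F n"
  for c :: "'a::field"
proof -
  have "F * (1 + fps_const c * fps_X) = F + fps_const c * (fps_X * F)"
    by (simp add: algebra_simps)
  then show ?thesis
    by simp
qed

text \<open>The finite q-binomial theorem. Appending one linear factor acts on coefficients as the
  q-Pascal rule does, since \<open>q ^ n = q ^ (n - k) * q ^ k\<close>.\<close>

lemma fps_nth_qprod:
  assumes q: "qgeneric q"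
  shows "fps_nth (qprod c q n) m = q ^ (m choose 2) * c ^ m * gauss q n m"
proof (induction n arbitrary: m)
  case 0
  show ?case
    using gauss_0[OF q] by (cases m) (simp_all add: gauss_eq_0 numeral_2_eq_2 del: gauss_0)
next
  case (Suc n)
  show ?case
  proof (cases m)
    case 0
    then show ?thesis
      by (simp only: qprod_Suc fps_nth_mult_linear_0 Suc gauss_0[OF q])
  next
    case (Suc k)
    have ch: "Suc k choose 2 = (k choose 2) + k"
      by (simp add: numeral_2_eq_2)
    consider "k \<le> n" | "n < k" by linarith
    then show ?thesis
    proof cases
      case 1
      then have "q ^ n = q ^ (n - k) * q ^ k"
        by (simp flip: power_add)
      then show ?thesis
        unfolding \<open>m = Suc k\<close> qprod_Suc fps_nth_mult_linear_Suc Suc.IH gauss_Suc_Suc[OF q 1] ch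
        by (simp add: algebra_simps power_add)
    next
      case 2
      then show ?thesis
        unfolding \<open>m = Suc k\<close> qprod_Suc fps_nth_mult_linear_Suc Suc.IH
        by (simp add: gauss_eq_0)
    qed
  qed
qed

section \<open>Reciprocal products and the floored generating functions\<close>

definition qseries :: "'a::field \<Rightarrow> 'a \<Rightarrow> nat \<Rightarrow> 'a fps"
  where "qseries c q M = Abs_fps (\<lambda>n. c ^ n * gauss q (M + n) n)"

text \<open>This is the series \<open>G(c)\<close>, with \<open>q\<close> in the place of
  \<open>Q\<close>.\<close>

definition qseries2 :: "'a::field \<Rightarrow> 'a \<Rightarrow> nat \<Rightarrow> 'a fps"
  where "qseries2 c q M = Abs_fps (\<lambda>n. c ^ n * gauss (q\<^sup>2) (M + n div 2) (n div 2))"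

lemma geometric_fps: "Abs_fps (\<lambda>n. c ^ n) * qprod (- c) q 1 = 1" for c :: "'a::field"
proof (rule fps_ext)
  fix n
  show "fps_nth (Abs_fps (\<lambda>n. c ^ n) * qprod (- c) q 1) n = fps_nth 1 n"
    unfolding One_nat_def qprod_Suc qprod_0 mult_1_left
    by (cases n) (simp_all only: fps_nth_mult_linear_0 fps_nth_mult_linear_Suc, simp_all)
qed

text \<open>Coefficientwise, the q-Pascal rule says that the newest factor of the product lowers
  \<open>Suc M\<close> to \<open>M\<close> in the series.\<close>

lemma qseries_mult_qprod:
  assumes q: "qgeneric q"
  shows "qseries c q M * qprod (- c) q (Suc M) = 1"
proof (induction M)
  case 0
  show ?case
    using geometric_fps[of c q] q by (simp add: qseries_def gauss_self)
next
  case (Suc M)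
  let ?l = "1 + fps_const (- c * q ^ Suc M) * fps_X"
  have "qseries c q (Suc M) * ?l = qseries c q M"
  proof (rule fps_ext)
    fix n
    show "fps_nth (qseries c q (Suc M) * ?l) n = fps_nth (qseries c q M) n"
    proof (cases n)
      case 0
      then show ?thesis
        using gauss_0[OF q] by (simp only: fps_nth_mult_linear_0) (simp add: qseries_def)
    next
      case (Suc k)
      have "gauss q (Suc (Suc M + k)) (Suc k)
          = gauss q (Suc M + k) (Suc k) + q ^ Suc M * gauss q (Suc M + k) k"
        using gauss_Suc_Suc[OF q, of k "Suc M + k"] by simp
      then have "gauss q (Suc M + Suc k) (Suc k)
          = gauss q (M + Suc k) (Suc k) + q ^ Suc M * gauss q (Suc M + k) k"
        by (simp only: add_Suc_right add_Suc)
      then show ?thesis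
        unfolding Suc fps_nth_mult_linear_Suc
        by (simp add: qseries_def algebra_simps)
    qed
  qed
  moreover have "qseries c q (Suc M) * qprod (- c) q (Suc (Suc M))
      = qseries c q (Suc M) * ?l * qprod (- c) q (Suc M)"
    unfolding qprod_Suc[of "- c" q "Suc M"] by (simp only: mult_ac)
  ultimately show ?case
    using Suc by simp
qed

text \<open>The denominator \<open>(c^2 X^2; q^2)\<close> splits into the products of
  \<open>1 - c q^i X\<close> and of \<open>1 + c q^i X\<close>; the numerator \<open>1 + c X\<close>
  cancels the factor \<open>i = 0\<close> of the latter, which leaves length \<open>M\<close> and
  start \<open>c * q\<close>.\<close>

lemma qseries2_mult_qprod:
  assumes q: "qgeneric (q\<^sup>2)"
  shows "qseries2 c q M * qprod (c * q) q M * qprod (- c) q (Suc M) = 1"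
proof (induction M)
  case 0
  show ?case
    using geometric_fps[of c q] q by (simp add: qseries2_def gauss_self)
next
  case (Suc M)
  let ?d = "c * q ^ Suc M"
  let ?l = "1 + fps_const ?d * fps_X"
  let ?l' = "1 + fps_const (- ?d) * fps_X"
  \<comment> \<open>The product \<open>?l * ?l'\<close> is \<open>1 - ?d^2 X^2\<close>, so only
    degrees two apart interact; their halves differ by one, and the q-Pascal rule in base
    \<open>q^2\<close> applies. Degrees 0 and 1 have no such partner.\<close>
  have step: "qseries2 c q (Suc M) * ?l * ?l' = qseries2 c q M"
  proof (rule fps_ext)
    fix n
    have n: "n = 0 \<or> n = 1 \<or> (\<exists>k. n = Suc (Suc k))"
      by (metis One_nat_def not0_implies_Suc)
    show "fps_nth (qseries2 c q (Suc M) * ?l * ?l') n = fps_nth (qseries2 c q M) n"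
    proof (cases "n = 0 \<or> n = 1")
      case True
      then show ?thesis
      proof
        assume "n = 0"
        then show ?thesis
          using gauss_0[OF q] by (simp only: fps_nth_mult_linear_0) (simp add: qseries2_def)
      next
        assume "n = 1"
        then show ?thesis
          unfolding One_nat_def using gauss_0[OF q]
          by (simp only: fps_nth_mult_linear_0 fps_nth_mult_linear_Suc) (simp add: qseries2_def)
      qed
    next
      case False
      then obtain k where k: "n = Suc (Suc k)"
        using n by blast
      define h where "h = k div 2"
      have h: "Suc (Suc k) div 2 = Suc h"
        by (simp add: h_def)
      have "gauss (q\<^sup>2) (Suc (Suc M + h)) (Suc h)
          = gauss (q\<^sup>2) (Suc M + h) (Suc h) + (q\<^sup>2) ^ Suc M * gauss (q\<^sup>2) (Suc M + h) h"
        using gauss_Suc_Suc[OF q, of h "Suc M + h"] by simp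
      then have "gauss (q\<^sup>2) (Suc M + Suc h) (Suc h)
          = gauss (q\<^sup>2) (M + Suc h) (Suc h) + q ^ Suc M * q ^ Suc M * gauss (q\<^sup>2) (Suc M + h) h"
        by (simp only: add_Suc_right add_Suc power_mult_distrib power2_eq_square)
      then show ?thesis
        unfolding k fps_nth_mult_linear_Suc qseries2_def fps_nth_Abs_fps h h_def[symmetric]
        by (simp add: algebra_simps)
    qed
  qed
  have "qprod (c * q) q (Suc M) = qprod (c * q) q M * ?l"
    by (simp add: qprod_Suc mult_ac)
  moreover have "qprod (- c) q (Suc (Suc M)) = qprod (- c) q (Suc M) * ?l'"
    by (simp only: qprod_Suc[of "- c" q "Suc M"]) simp
  ultimately have "qseries2 c q (Suc M) * qprod (c * q) q (Suc M) * qprod (- c) q (Suc (Suc M))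
      = qseries2 c q (Suc M) * ?l * ?l' * qprod (c * q) q M * qprod (- c) q (Suc M)"
    by (simp only: mult_ac)
  then show ?case
    unfolding step using Suc by simp
qed

text \<open>Both sides are inverse to \<open>?P\<close>. This is the cancellation that removes the
  floors.\<close>

lemma qseries2_eq_qseries:
  assumes "qgeneric q" "qgeneric (q\<^sup>2)"
  shows "qprod (c * q) q M * qseries2 c q M = qseries c q M"
proof -
  let ?P = "qprod (- c) q (Suc M)"
  have "?P \<noteq> 0"
    using qseries_mult_qprod[OF assms(1), of c M] by auto
  moreover have "qprod (c * q) q M * qseries2 c q M * ?P = qseries c q M * ?P"
    using qseries_mult_qprod[OF assms(1), of c M] qseries2_mult_qprod[OF assms(2), of c M]
    by (simp add: mult_ac)
  ultimately show ?thesis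
    by simp
qed

lemma qprod_triple_mult_qseries2:
  assumes "qgeneric (q ^ 3)" "qgeneric (q ^ 6)"
  shows "qprod (q ^ 3) q (3 * M) * (qseries2 q (q ^ 3) M * qseries2 (q\<^sup>2) (q ^ 3) M)
       = qprod (q\<^sup>2 * q) (q ^ 3) M * (qseries (q\<^sup>2) (q ^ 3) M * qseries q (q ^ 3) M)"
proof -
  have "qgeneric ((q ^ 3)\<^sup>2)"
    using assms(2) by (simp flip: power_mult)
  note eq = qseries2_eq_qseries[OF assms(1) this, of _ M]
  \<comment> \<open>The residue classes start at \<open>q^3\<close>, \<open>q^4\<close>,
    \<open>q^5\<close>. The last two have the form \<open>c * q ^ 3\<close> needed for cancellation
    with \<open>c = q\<close> and \<open>c = q^2\<close>; the first is the product of these two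
    parameters.\<close>
  have "q ^ 3 * q = q * q ^ 3" "q ^ 3 * q\<^sup>2 = q\<^sup>2 * q ^ 3" "q\<^sup>2 * q = q ^ 3"
    by (simp_all add: mult_ac power2_eq_square power3_eq_cube)
  then show ?thesis
    unfolding qprod_triple[of _ q] eq[symmetric] by (simp add: mult_ac)
qed

section \<open>The q-Vandermonde identity and the two-parameter summation\<close>

lemma choose_2_add: "(m + n) choose 2 = (m choose 2) + (n choose 2) + m * n"
proof (induction n)
  case (Suc n)
  then show ?case
    by (simp add: numeral_2_eq_2)
qed simp

text \<open>Compares coefficients of \<open>X^k\<close> after cutting a product of
  \<open>m + n\<close> factors behind the first \<open>m\<close>; \<open>q ^ (k choose 2)\<close>
  then cancels.\<close>

lemma q_Vandermonde:
  assumes q: "qgeneric q" and "q \<noteq> 0"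
  shows "(\<Sum>r\<le>k. q ^ ((k - r) * (m - r)) * gauss q m r * gauss q n (k - r)) = gauss q (m + n) k"
proof -
  have "q ^ (k choose 2) * gauss q (m + n) k = fps_nth (qprod 1 q (m + n)) k"
    by (simp add: fps_nth_qprod[OF q])
  also have "\<dots> = (\<Sum>r\<le>k. fps_nth (qprod 1 q m) r * fps_nth (qprod (q ^ m) q n) (k - r))"
    by (simp add: qprod_add fps_mult_nth atLeast0AtMost)
  also have "\<dots> = (\<Sum>r\<le>k. q ^ (k choose 2) *
      (q ^ ((k - r) * (m - r)) * gauss q m r * gauss q n (k - r)))"
  proof (rule sum.cong[OF refl])
    fix r assume "r \<in> {..k}"
    then obtain t where k: "k = r + t"
      using le_Suc_ex by auto
    show "fps_nth (qprod 1 q m) r * fps_nth (qprod (q ^ m) q n) (k - r)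
        = q ^ (k choose 2) * (q ^ ((k - r) * (m - r)) * gauss q m r * gauss q n (k - r))"
    \<comment> \<open>For \<open>r > m\<close> the truncated exponent \<open>m - r\<close> is
      harmless because \<open>gauss q m r\<close> vanishes.\<close>
    proof (cases "r \<le> m")
      case True
      then obtain u where m: "m = r + u"
        using le_Suc_ex by auto
      show ?thesis
        unfolding fps_nth_qprod[OF q] k m
        by (simp add: choose_2_add power_add power_mult algebra_simps flip: power_mult)
    qed (simp add: fps_nth_qprod[OF q] gauss_eq_0)
  qed
  finally show ?thesis
    using \<open>q \<noteq> 0\<close> by (simp add: sum_distrib_left[symmetric])
qed

text \<open>The series may change with the degree \<open>s\<close> at which they are read, as needed
  for products whose length depends on \<open>N - s\<close>.\<close>

lemma sum_fps_nth_mult3: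
  fixes f g h :: "nat \<Rightarrow> 'a::comm_ring_1 fps" and w :: "nat \<Rightarrow> 'a"
  shows "(\<Sum>s\<le>N. w s * fps_nth (f s * (g s * h s)) s)
       = (\<Sum>(i, j, k)\<in>{(i, j, k). i + j + k \<le> N}. w (i + j + k) *
           (fps_nth (f (i + j + k)) i * (fps_nth (g (i + j + k)) j * fps_nth (h (i + j + k)) k)))"
    (is "?lhs = ?rhs")
proof -
  have "?lhs = (\<Sum>s\<le>N. \<Sum>i\<le>s. \<Sum>j\<le>s - i.
      w s * (fps_nth (f s) i * (fps_nth (g s) j * fps_nth (h s) (s - i - j))))"
    by (simp add: fps_mult_nth atLeast0AtMost sum_distrib_left)
  also have "\<dots> = (\<Sum>(s, i, j)\<in>(SIGMA s:{..N}. SIGMA i:{..s}. {..s - i}).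
      w s * (fps_nth (f s) i * (fps_nth (g s) j * fps_nth (h s) (s - i - j))))"
    by (simp add: sum.Sigma)
  also have "\<dots> = ?rhs"
    by (rule sum.reindex_bij_witness[where i = "\<lambda>(i, j, k). (i + j + k, i, j)"
          and j = "\<lambda>(s, i, j). (i, j, s - i - j)"]) auto
  finally show ?thesis .
qed

text \<open>Both sides are the q-multinomial with parts \<open>L\<close>, \<open>r\<close>,
  \<open>i - r\<close>.\<close>

lemma gauss_trinomial_revision:
  assumes q: "qgeneric q" and "r \<le> i"
  shows "gauss q (L + r) r * gauss q (L + i) (i - r) = gauss q i r * gauss q (L + i) i"
proof -
  have "r \<le> L + r" "i - r \<le> L + i" "i \<le> L + i" "L + i - (i - r) = L + r"
    using assms(2) by simp_all
  then show ?thesis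
    using q \<open>r \<le> i\<close> by (simp add: gauss_eq)
qed

text \<open>Both sides are the q-multinomial with parts \<open>L\<close>, \<open>i\<close>,
  \<open>j\<close>.\<close>

lemma gauss_mult_gauss_add:
  assumes q: "qgeneric q"
  shows "gauss q (L + i) i * gauss q (L + i + j) j = gauss q (L + i + j) i * gauss q (L + j) j"
  using q gauss_eq[of i "L + i" q] gauss_eq[of j "L + i + j" q] gauss_eq[of i "L + i + j" q]
    gauss_eq[of j "L + j" q]
  by (simp add: add.commute)

lemma finite_sum_le: "finite {(i, j). i + j \<le> (N::nat)}"
  by (rule finite_subset[of _ "{..N} \<times> {..N}"]) auto

lemma finite_sum3_le: "finite {(i, j, k). i + j + k \<le> (N::nat)}"
  by (rule finite_subset[of _ "{..N} \<times> {..N} \<times> {..N}"]) auto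

text \<open>Degrees \<open>r\<close>, \<open>u\<close>, \<open>v\<close> in the three factors
  contribute \<open>a^(r+u) b^(r+v)\<close>. Grouping by \<open>i = r + u\<close> and
  \<open>j = r + v\<close> leaves an inner sum over \<open>r\<close> of q-Vandermonde type.\<close>

lemma sum_qprod_qseries:
  assumes q: "qgeneric q" and q0: "q \<noteq> 0"
  shows "(\<Sum>s\<le>N. q ^ (s choose 2) *
            fps_nth (qprod (a * b) q (N - s) * (qseries a q (N - s) * qseries b q (N - s))) s)
       = (\<Sum>(i, j)\<in>{(i, j). i + j \<le> N}. a ^ i * b ^ j * q ^ ((i choose 2) + (j choose 2)) *
            (gauss q N i * gauss q (N - i) j))"
    (is "?lhs = ?rhs")
proof -
  define T where "T = (\<lambda>(r, u, v). q ^ ((r + u + v) choose 2) *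
    (fps_nth (qprod (a * b) q (N - (r + u + v))) r *
      (fps_nth (qseries a q (N - (r + u + v))) u * fps_nth (qseries b q (N - (r + u + v))) v)))"
  define c where "c i j = a ^ i * b ^ j * q ^ ((i choose 2) + (j choose 2))" for i j
  have T_eq: "T (r, i - r, j - r) = c i j * gauss q (N - (i + j) + i) i *
      (q ^ ((j - r) * (i - r)) * gauss q i r * gauss q (N - (i + j) + j) (j - r))"
    if le: "i + j \<le> N" "r \<le> i" "r \<le> j" for i j r
  proof -
    obtain u v where uv: "i = r + u" "j = r + v"
      using le le_Suc_ex by metis
    obtain L where L: "N = L + i + j"
      using le le_Suc_ex by (metis add.assoc add.commute)
    have M: "N - (r + u + v) = L + r" "N - (i + j) = L" "i - r = u" "j - r = v"
      using L uv by auto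
    \<comment> \<open>The exponents agree because \<open>((r+u+v) choose 2) + (r choose 2) = (i
      choose 2) + (j choose 2) + u * v\<close>.\<close>
    have "T (r, u, v) = c i j * q ^ (v * u) *
        (gauss q (L + r) r * gauss q (L + i) u) * gauss q (L + j) v"
      unfolding T_def c_def M prod.case fps_nth_qprod[OF q] qseries_def fps_nth_Abs_fps
      unfolding uv choose_2_add
      by (simp add: power_add power_mult power_mult_distrib mult_ac add_ac add_mult_distrib
          add_mult_distrib2
          flip: power_mult)
    also have "gauss q (L + r) r * gauss q (L + i) u = gauss q i r * gauss q (L + i) i"
      using gauss_trinomial_revision[OF q \<open>r \<le> i\<close>, of L] by (simp only: M)
    finally show ?thesis
      unfolding M by (simp only: mult_ac)
  qed
  have inner: "(\<Sum>r\<le>min i j. T (r, i - r, j - r)) = c i j * (gauss q N i * gauss q (N - i) j)"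
    if le: "i + j \<le> N" for i j
  proof -
    define L where "L = N - (i + j)"
    have L: "N = L + i + j" "N - i = L + j"
      using le by (auto simp: L_def)
    let ?V = "\<lambda>r. q ^ ((j - r) * (i - r)) * gauss q i r * gauss q (L + j) (j - r)"
    have "(\<Sum>r\<le>min i j. T (r, i - r, j - r)) = (\<Sum>r\<le>min i j. c i j * gauss q (L + i) i * ?V r)"
      using T_eq[OF le] by (intro sum.cong) (auto simp: L_def)
    also have "\<dots> = c i j * gauss q (L + i) i * (\<Sum>r\<le>min i j. ?V r)"
      by (simp only: sum_distrib_left)
    \<comment> \<open>The added terms have \<open>r > i\<close>, where \<open>gauss q i r\<close> is
      zero.\<close>
    also have "(\<Sum>r\<le>min i j. ?V r) = (\<Sum>r\<le>j. ?V r)"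
      by (rule sum.mono_neutral_left) (auto simp: gauss_eq_0)
    also have "\<dots> = gauss q (L + i + j) j"
      using q_Vandermonde[OF q q0, of j i "L + j"] by (simp add: add_ac)
    finally show ?thesis
      using gauss_mult_gauss_add[OF q, of L i j] L by (simp add: mult.assoc)
  qed
  have "?lhs = (\<Sum>x\<in>{(r, u, v). r + u + v \<le> N}. T x)"
    unfolding T_def by (rule sum_fps_nth_mult3)
  \<comment> \<open>The terms with \<open>N - s < r\<close> vanish; only for the others is \<open>i + j \<le> N\<close> after substituting
    \<open>i = u + r\<close>, \<open>j = v + r\<close>.\<close>
  also have "\<dots> = (\<Sum>x\<in>{(r, u, v). r + u + v + r \<le> N}. T x)"
  proof (rule sum.mono_neutral_right[OF finite_sum3_le])
    show "\<forall>x\<in>{(r, u, v). r + u + v \<le> N} - {(r, u, v). r + u + v + r \<le> N}. T x = 0"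
    proof
      fix x assume "x \<in> {(r, u, v). r + u + v \<le> N} - {(r, u, v). r + u + v + r \<le> N}"
      then obtain r u v where x: "x = (r, u, v)" "r + u + v \<le> N" "\<not> r + u + v + r \<le> N"
        by blast
      then have "gauss q (N - (r + u + v)) r = 0"
        by (intro gauss_eq_0) linarith
      then show "T x = 0"
        by (simp add: T_def x fps_nth_qprod[OF q])
    qed
  qed auto
  also have "\<dots> = (\<Sum>((i, j), r)\<in>(SIGMA p:{(i, j). i + j \<le> N}. {..min (fst p) (snd p)}).
      T (r, i - r, j - r))"
    by (rule sum.reindex_bij_witness[where i = "\<lambda>((i, j), r). (r, i - r, j - r)"
          and j = "\<lambda>(r, u, v). ((u + r, v + r), r)"]) auto
  also have "\<dots> = (\<Sum>p\<in>{(i, j). i + j \<le> N}. \<Sum>r\<le>min (fst p) (snd p).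
      T (r, fst p - r, snd p - r))"
    by (subst sum.Sigma) (auto simp: finite_sum_le split_beta)
  also have "\<dots> = ?rhs"
    by (rule sum.cong[OF refl]) (auto simp: inner c_def)
  finally show ?thesis .
qed

section \<open>Exponents, and both sides as finite sums\<close>

lemma two_mult_choose_2: "2 * int (k choose 2) = int k * (int k - 1)"
proof (induction k)
  case (Suc k)
  then show ?case
    by (simp add: numeral_2_eq_2 algebra_simps)
qed simp

text \<open>The quotient in \<open>A_exp\<close> is a triangular number, so doubling gives a
  polynomial identity. The result is a natural number, which turns \<open>powi\<close> into an
  ordinary power.\<close>

lemma A_exp_eq:
  "A_exp (int n1) (int n2) (int m)
    = int (3 * ((m + n1 + n2) choose 2) + (m choose 2) + 3 * m + n1 + 2 * n2)"
proof -
  have "(2 * int m + int n1 + int n2 + 1) * (2 * int m + int n1 + int n2)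
      = 2 * int ((2 * m + n1 + n2 + 1) choose 2)"
    unfolding two_mult_choose_2 by (simp add: algebra_simps)
  then have "2 * A_exp (int n1) (int n2) (int m)
      = 2 * int ((2 * m + n1 + n2 + 1) choose 2)
        + 2 * (int m * (int n1 + int n2) + (int n1 + int n2)\<^sup>2 - int n1)"
    by (simp add: A_exp_def)
  also have "\<dots> = 3 * (2 * int ((m + n1 + n2) choose 2)) + 2 * int (m choose 2)
      + 2 * (3 * int m + int n1 + 2 * int n2)"
    unfolding two_mult_choose_2 by (simp add: algebra_simps power2_eq_square)
  finally show ?thesis
    by simp
qed

lemma qgeneric_qvar: "d > 0 \<Longrightarrow> qgeneric (qvar ^ d)"
  using qpochhammer_qvar_nonzero by blast

lemma qvar_nonzero: "qvar \<noteq> 0"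
  by (simp add: qvar_def)

lemma sum_lhs_summand:
  "Sum_any (\<lambda>(m, n1, n2). lhs_summand (int N) m n1 n2) = (\<Sum>s\<le>N. (qvar ^ 3) ^ (s choose 2) *
     fps_nth (qprod (qvar ^ 3) qvar (3 * (N - s)) * (qseries2 qvar (qvar ^ 3) (N - s)
       * qseries2 (qvar\<^sup>2) (qvar ^ 3) (N - s))) s)"
proof -
  have "qgeneric qvar"
    using qgeneric_qvar[of 1] by simp
  note nth = fps_nth_qprod[OF this]
  \<comment> \<open>A nonzero first q-binomial forces \<open>3 * M >= m >= 0\<close>, hence
    \<open>M >= 0\<close>, and natural subtraction in \<open>N - s\<close> is faithful.\<close>
  have "{(m, n1, n2). lhs_summand (int N) m n1 n2 \<noteq> 0} \<subseteq> {(m, n1, n2). m + n1 + n2 \<le> N}"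
  proof clarify
    fix m n1 n2 assume "lhs_summand (int N) m n1 n2 \<noteq> 0"
    then have "qbinomial qvar (3 * (int N - int m - int n1 - int n2)) (int m) \<noteq> 0"
      by (force simp: lhs_summand_def Let_def)
    then have "int m \<le> 3 * (int N - int m - int n1 - int n2)"
      unfolding qbinomial_def by meson
    then show "m + n1 + n2 \<le> N"
      by arith
  qed
  then have "Sum_any (\<lambda>(m, n1, n2). lhs_summand (int N) m n1 n2)
      = (\<Sum>(m, n1, n2)\<in>{(m, n1, n2). m + n1 + n2 \<le> N}. lhs_summand (int N) m n1 n2)"
    by (intro Sum_any.expand_superset finite_sum3_le) auto
  also have "\<dots> = (\<Sum>(m, n1, n2)\<in>{(m, n1, n2). m + n1 + n2 \<le> N}.
      (qvar ^ 3) ^ ((m + n1 + n2) choose 2) *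
      (fps_nth (qprod (qvar ^ 3) qvar (3 * (N - (m + n1 + n2)))) m *
        (fps_nth (qseries2 qvar (qvar ^ 3) (N - (m + n1 + n2))) n1
          * fps_nth (qseries2 (qvar\<^sup>2) (qvar ^ 3) (N - (m + n1 + n2))) n2)))"
  proof (intro sum.cong refl, clarify)
    fix m n1 n2 assume "m + n1 + n2 \<le> N"
    then obtain M where N: "N = M + (m + n1 + n2)"
      using le_Suc_ex by (metis add.commute)
    have M: "int N - int m - int n1 - int n2 = int M" "N - (m + n1 + n2) = M"
      using N by simp_all
    have "qvar powi A_exp (int n1) (int n2) (int m) = (qvar ^ 3) ^ ((m + n1 + n2) choose 2)
        * (qvar ^ (m choose 2) * (qvar ^ 3) ^ m * (qvar ^ n1 * (qvar\<^sup>2) ^ n2))"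
      unfolding A_exp_eq power_int_of_nat
      unfolding power_add power_mult by (simp only: mult_ac)
    moreover have "(qvar ^ 3)\<^sup>2 = qvar ^ 6"
      by (simp flip: power_mult)
    ultimately show "lhs_summand (int N) m n1 n2 = (qvar ^ 3) ^ ((m + n1 + n2) choose 2) *
      (fps_nth (qprod (qvar ^ 3) qvar (3 * (N - (m + n1 + n2)))) m *
        (fps_nth (qseries2 qvar (qvar ^ 3) (N - (m + n1 + n2))) n1
          * fps_nth (qseries2 (qvar\<^sup>2) (qvar ^ 3) (N - (m + n1 + n2))) n2))"
      unfolding lhs_summand_def Let_def M nth qseries2_def fps_nth_Abs_fps gauss_def
      by (simp add: mult_ac)
  qed
  finally show ?thesis
    by (simp only: sum_fps_nth_mult3)
qed

text \<open>The new indices are \<open>k\<close> and \<open>k + j\<close>, the lower entries of the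
  two q-binomials in the trinomial.\<close>

lemma sum_qtrinomial:
  "(\<Sum>j\<in>{-int N..int N}. qvar powi (j * (3 * j - 1) div 2) * qtrinomial (int N) j (qvar ^ 3) j)
    = (\<Sum>(i, j)\<in>{(i, j). i + j \<le> N}. (qvar\<^sup>2) ^ i * qvar ^ j *
        (qvar ^ 3) ^ ((i choose 2) + (j choose 2)) *
        (gauss (qvar ^ 3) N i * gauss (qvar ^ 3) (N - i) j))"
proof -
  let ?t = "\<lambda>j k. (qvar ^ 3) powi (int k * (int k + j)) * qbinomial (qvar ^ 3) (int N) (int k)
    * qbinomial (qvar ^ 3) (int N - int k) (int k + j)"
  let ?e = "\<lambda>j. qvar powi (j * (3 * j - 1) div 2)"
  let ?S = "{(j, k). 0 \<le> int k + j \<and> int k + j \<le> int N - int k}"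
  have "qtrinomial (int N) j (qvar ^ 3) j = (\<Sum>k\<le>N. ?t j k)" for j
    unfolding qtrinomial_def
    by (rule Sum_any.expand_superset) (auto simp: qbinomial_def)
  then have "(\<Sum>j\<in>{-int N..int N}. ?e j * qtrinomial (int N) j (qvar ^ 3) j)
      = (\<Sum>(j, k)\<in>{-int N..int N} \<times> {..N}. ?e j * ?t j k)"
    by (simp add: sum_distrib_left sum.cartesian_product)
  also have "\<dots> = (\<Sum>(j, k)\<in>?S. ?e j * ?t j k)"
  proof (rule sum.mono_neutral_right)
    show "\<forall>p\<in>{-int N..int N} \<times> {..N} - ?S. (case p of (j, k) \<Rightarrow> ?e j * ?t j k) = 0"
    proof
      fix p assume "p \<in> {-int N..int N} \<times> {..N} - ?S"
      then obtain j k where p: "p = (j, k)" "\<not> (0 \<le> int k + j \<and> int k + j \<le> int N - int k)"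
        by blast
      then have "qbinomial (qvar ^ 3) (int N - int k) (int k + j) = 0"
        unfolding qbinomial_def by meson
      then show "(case p of (j, k) \<Rightarrow> ?e j * ?t j k) = 0"
        by (simp add: p)
    qed
  qed auto
  also have "\<dots> = (\<Sum>(i, j)\<in>{(i, j). i + j \<le> N}. (qvar\<^sup>2) ^ i * qvar ^ j *
        (qvar ^ 3) ^ ((i choose 2) + (j choose 2)) *
        (gauss (qvar ^ 3) N i * gauss (qvar ^ 3) (N - i) j))"
  proof (rule sum.reindex_bij_witness[where i = "\<lambda>(i, j). (int j - int i, i)"
        and j = "\<lambda>(j, k). (k, nat (int k + j))"], goal_cases)
    case (5 p)
    obtain d k where p: "p = (d, k)"
      by (cases p)
    define l where "l = nat (int k + d)"
    have d: "d = int l - int k" and le: "k \<le> N" "l \<le> N - k"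
      using 5 by (auto simp: p l_def)
    \<comment> \<open>With \<open>l = k + d\<close>, the cross term \<open>-3 k l\<close> of the
      pentagonal exponent is cancelled by the weight \<open>k * (k + d) = k * l\<close> in base
      \<open>qvar ^ 3\<close>; what remains separates in \<open>k\<close> and
      \<open>l\<close>.\<close>
    have "d * (3 * d - 1)
        = 2 * (int (3 * (k choose 2) + 3 * (l choose 2) + 2 * k + l) - 3 * (int k * int l))"
      using two_mult_choose_2[of k] two_mult_choose_2[of l]
      by (simp add: d algebra_simps)
    then have "?e d = qvar powi (int (3 * (k choose 2) + 3 * (l choose 2) + 2 * k + l)
        - 3 * (int k * int l))"
      by simp
    moreover have "(qvar ^ 3) powi (int k * int l) = qvar powi (3 * (int k * int l))"
      by (simp add: power_int_power)
    ultimately have "?e d * (qvar ^ 3) powi (int k * int l)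
        = qvar powi (int (3 * (k choose 2) + 3 * (l choose 2) + 2 * k + l)
            - 3 * (int k * int l) + 3 * (int k * int l))"
      by (simp only: power_int_add[OF disjI1[OF qvar_nonzero]])
    also have "\<dots> = qvar ^ (3 * (k choose 2) + 3 * (l choose 2) + 2 * k + l)"
      by (simp only: diff_add_cancel power_int_of_nat)
    also have "\<dots> = (qvar\<^sup>2) ^ k * qvar ^ l * (qvar ^ 3) ^ ((k choose 2) + (l choose 2))"
      unfolding power_add power_mult by (simp only: mult_ac)
    finally have eq: "?e d * (qvar ^ 3) powi (int k * int l)
        = (qvar\<^sup>2) ^ k * qvar ^ l * (qvar ^ 3) ^ ((k choose 2) + (l choose 2))" .
    have kd: "int k + d = int l" "int N - int k = int (N - k)"
      using d le by simp_all
    show ?case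
      unfolding p prod.case gauss_def l_def[symmetric] kd nat_int eq[symmetric]
      by (simp only: mult.assoc)
  qed auto
  finally show ?thesis .
qed

theorem theorem1p2:
  fixes N :: int
  shows "Sum_any (\<lambda>(m, n1, n2). lhs_summand N m n1 n2)
       = (\<Sum>j\<in>{-N..N}. qvar powi (j * (3 * j - 1) div 2) * qtrinomial N j (qvar ^ 3) j)"
proof (cases "N < 0")
  case True
  \<comment> \<open>Here \<open>3 * M\<close> is negative, so the first q-binomial takes its default
    value \<open>0\<close>.\<close>
  then have "lhs_summand N m n1 n2 = 0" for m n1 n2
    by (simp add: lhs_summand_def Let_def qbinomial_def)
  with True show ?thesis
    by (simp add: split_beta)
next
  case False
  then obtain n where N: "N = int n"
    using nonneg_int_cases by (metis linorder_not_less)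
  have q3: "qgeneric (qvar ^ 3)" and q6: "qgeneric (qvar ^ 6)" and nz: "qvar ^ 3 \<noteq> 0"
    using qgeneric_qvar[of 3] qgeneric_qvar[of 6] qvar_nonzero by simp_all
  show ?thesis
    \<comment> \<open>The summation is used with \<open>a = qvar^2\<close>, \<open>b = qvar\<close>
      and base \<open>qvar ^ 3\<close>.\<close>
    unfolding N sum_lhs_summand sum_qtrinomial qprod_triple_mult_qseries2[OF q3 q6]
    by (rule sum_qprod_qseries[OF q3 nz])
qed

end
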